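(* Let $n\in\mathbb{N}$ and let $\mathcal{B}$ and $\mathcal{C}$ be finite $n$-dimensional signed barcodes with the same total mass. Then $$\widehat{d_{W^1}}(\mathcal{B},\mathcal{C}) = \|\nu_{\mathcal{B}} - \nu_{\mathcal{C}}\|_1^{\mathsf{K}}.$$
   Context: An $n$-dimensional barcode is a multiset of elements of $\mathbb{R}^n$; a signed barcode is an ordered pair $\mathcal{B}=(\mathcal{B}_+,\mathcal{B}_-)$ of barcodes; $\cup$ is disjoint union of multisets (multiplicities add). The total mass of a finite signed barcode $\mathcal{B}$ is the cardinality of $\mathcal{B}_+$ minus that of $\mathcal{B}_-$. The associated finite signed Radon measure on $\mathbb{R}^n$ is $\nu_{\mathcal{B}} = \sum_{i\in\mathcal{B}_+}\delta_i - \sum_{j\in\mathcal{B}_-}\delta_j$, where $\delta_i$ is the Dirac measure at $i$. For finite barcodes, $d_{W^1}(\mathcal{B},\mathcal{C}) \in [0,\infty]$ is the infimum of $\sum_{i \in \mathcal{B}} \|i - h(i)\|_1$ over all bijections of multisets $h : \mathcal{B} \to \mathcal{C}$ ($\infty$ if there is none). For finite signed barcodes, $\widehat{d_{W^1}}(\mathcal{B},\mathcal{C}) = d_{W^1}(\mathcal{B}_+\cup\mathcal{C}_-,\ \mathcal{C}_+\cup\mathcal{B}_-)$. For a finite signed Radon measure $\nu$ on $\mathbb{R}^n$ of total mass $0$ with Jordan decomposition $\nu=\nu_+-\nu_-$, the Kantorovich norm is $$\|\nu\|_1^{\mathsf{K}} = \inf\left\{\int_{\mathbb{R}^n\times\mathbb{R}^n}\|x-y\|_1\,d\psi(x,y)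 : \psi \text{ is a coupling between } \nu_+ \text{ and } \nu_-\right\},$$ where a coupling is a positive measure on $\mathbb{R}^n\times\mathbb{R}^n$ with marginals $\nu_+$ and $\nu_-$. *)

theory Defs
  imports "HOL-Analysis.Analysis" "HOL-Probability.Giry_Monad" "HOL-Library.Multiset"
begin

text \<open>Multisets in HOL are finite, so these are exactly the finite barcodes;
  disjoint union of barcodes is \<open>+\<close>.\<close>

type_synonym 'n barcode = "(real ^ 'n) multiset"
type_synonym 'n signed_barcode = "'n barcode \<times> 'n barcode"

abbreviation pos_bars :: "('n::finite) signed_barcode \<Rightarrow> 'n barcode" where
  "pos_bars \<equiv> fst"

abbreviation neg_bars :: "('n::finite) signed_barcode \<Rightarrow> 'n barcode" where
  "neg_bars \<equiv> snd"

definition total_mass :: "('n::finite) signed_barcode \<Rightarrow> int" where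
  "total_mass B = int (size (pos_bars B)) - int (size (neg_bars B))"

definition l1_norm :: "real ^ ('n::finite) \<Rightarrow> real" where
  "l1_norm x = (\<Sum>i\<in>UNIV. \<bar>x $ i\<bar>)"

text \<open>The elements of a multiset, with \<open>count M x\<close> distinguishable copies of each \<open>x\<close>:
  a bijection of multisets is a bijection between these sets.\<close>

definition elems :: "'a multiset \<Rightarrow> ('a \<times> nat) set" where
  "elems M = {(x, k). k < count M x}"

text \<open>In \<open>ennreal\<close> the infimum of the empty set is \<open>\<infinity>\<close>.\<close>

definition dW1 :: "('n::finite) barcode \<Rightarrow> 'n barcode \<Rightarrow> ennreal" where
  "dW1 B C = (INF h \<in> {h. bij_betw h (elems B) (elems C)}.
     ennreal (\<Sum>i\<in>elems B. l1_norm (fst i - fst (h i))))"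

definition signed_dW1 :: "('n::finite) signed_barcode \<Rightarrow> 'n signed_barcode \<Rightarrow> ennreal" where
  "signed_dW1 B C = dW1 (pos_bars B + neg_bars C) (pos_bars C + neg_bars B)"

text \<open>A finite signed Radon measure on \<open>real ^ 'n\<close> is represented by its real-valued set function
  on the Borel sets; every finite Borel measure on this space is Radon. The library's Dirac
  measure is \<open>return\<close>.\<close>

definition barcode_measure :: "('n::finite) signed_barcode \<Rightarrow> (real ^ 'n) set \<Rightarrow> real" where
  "barcode_measure B A =
     (\<Sum>i\<in>#pos_bars B. measure (return borel i) A) - (\<Sum>j\<in>#neg_bars B. measure (return borel j) A)"

text \<open>A pair of finite mutually singular positive measures with difference \<open>\<nu>\<close>; it is unique
  (shown below), and by the Hahn--Jordan theorem it exists for every finite signed measure.\<close>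

definition is_jordan_decomposition ::
    "('a::topological_space set \<Rightarrow> real) \<Rightarrow> 'a measure \<times> 'a measure \<Rightarrow> bool" where
  "is_jordan_decomposition \<nu> = (\<lambda>(P, N).
     finite_measure P \<and> finite_measure N \<and> sets P = sets borel \<and> sets N = sets borel \<and>
     (\<forall>A\<in>sets borel. \<nu> A = measure P A - measure N A) \<and>
     (\<exists>H\<in>sets borel. measure P (- H) = 0 \<and> measure N H = 0))"

lemma is_jordan_decomposition_unique:
  assumes "is_jordan_decomposition \<nu> PN" "is_jordan_decomposition \<nu> PN'"
  shows "PN = PN'"
proof -
  have main: "measure P A \<le> measure P' A"
    if J: "is_jordan_decomposition \<nu> (P, N)" "is_jordan_decomposition \<nu> (P', N')" "A \<in> sets borel"
    for P N P' N' A
  proof -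
    interpret P: finite_measure P using that by (simp add: is_jordan_decomposition_def)
    interpret N: finite_measure N using that by (simp add: is_jordan_decomposition_def)
    interpret P': finite_measure P' using that by (simp add: is_jordan_decomposition_def)
    have s: "sets P = sets borel" "sets N = sets borel" "sets P' = sets borel"
      using that by (auto simp: is_jordan_decomposition_def)
    have e: "measure P X - measure N X = measure P' X - measure N' X" if "X \<in> sets borel" for X
      using that \<open>is_jordan_decomposition \<nu> (P, N)\<close> \<open>is_jordan_decomposition \<nu> (P', N')\<close>
      by (auto simp: is_jordan_decomposition_def)
    obtain H where H: "H \<in> sets borel" "measure P (- H) = 0" "measure N H = 0"
      using J by (auto simp: is_jordan_decomposition_def)
    have "measure P A \<le> measure P ((A \<inter> H) \<union> - H)"
      using H that s by (intro P.finite_measure_mono) auto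
    also have "\<dots> \<le> measure P (A \<inter> H) + measure P (- H)"
      using H that s by (intro measure_Un_le) auto
    also have "\<dots> = measure P (A \<inter> H)"
      using H by simp
    also have "\<dots> = measure P' (A \<inter> H) - measure N' (A \<inter> H)"
    proof -
      have "measure N (A \<inter> H) \<le> measure N H"
        using H that s by (intro N.finite_measure_mono) auto
      then show ?thesis
        using e[of "A \<inter> H"] H that measure_nonneg[of N "A \<inter> H"] by auto
    qed
    also have "\<dots> \<le> measure P' A"
    proof -
      have "measure P' (A \<inter> H) \<le> measure P' A"
        using H that s by (intro P'.finite_measure_mono) auto
      then show ?thesis
        using measure_nonneg[of N' "A \<inter> H"] by linarith
    qed
    finally show ?thesis .
  qed
  obtain P N P' N' where eq: "PN = (P, N)" "PN' = (P', N')"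
    by (cases PN, cases PN') auto
  note J = assms[unfolded eq]
  have fm: "finite_measure P" "finite_measure N" "finite_measure P'" "finite_measure N'"
    and s: "sets P = sets borel" "sets N = sets borel" "sets P' = sets borel" "sets N' = sets borel"
    using J by (auto simp: is_jordan_decomposition_def)
  have p: "measure P A = measure P' A" if "A \<in> sets borel" for A
    using main[OF J that] main[OF J(2,1) that] by simp
  have n: "measure N A = measure N' A" if "A \<in> sets borel" for A
  proof -
    have "measure P A - measure N A = measure P' A - measure N' A"
      using that J by (auto simp: is_jordan_decomposition_def)
    with p[OF that] show ?thesis by simp
  qed
  have "P = P'"
    by (rule measure_eqI) (use s p fm in \<open>auto simp: finite_measure.emeasure_eq_measure\<close>)
  moreover have "N = N'"
    by (rule measure_eqI) (use s n fm in \<open>auto simp: finite_measure.emeasure_eq_measure\<close>)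
  ultimately show ?thesis by (simp add: eq)
qed

definition jordan_decomposition ::
    "('a::topological_space set \<Rightarrow> real) \<Rightarrow> 'a measure \<times> 'a measure" where
  "jordan_decomposition \<nu> = (THE PN. is_jordan_decomposition \<nu> PN)"

definition couplings ::
    "'a::topological_space measure \<Rightarrow> 'a measure \<Rightarrow> ('a \<times> 'a) measure set" where
  "couplings P N = {\<psi>. sets \<psi> = sets (borel \<Otimes>\<^sub>M borel) \<and>
     distr \<psi> borel fst = P \<and> distr \<psi> borel snd = N}"

text \<open>Meant for signed measures of total mass \<open>0\<close>; otherwise there is no coupling and the
  value is \<open>\<infinity>\<close>.\<close>

definition kantorovich_norm :: "((real ^ ('n::finite)) set \<Rightarrow> real) \<Rightarrow> ennreal" where
  "kantorovich_norm \<nu> = (case jordan_decomposition \<nu> of (P, N) \<Rightarrow>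
     INF \<psi> \<in> couplings P N. \<integral>\<^sup>+ (x, y). ennreal (l1_norm (x - y)) \<partial>\<psi>)"

end

theory Submission
  imports Defs "HOL-Combinatorics.Cycles"
begin

text \<open>
  Put \<open>M = B\<^sub>+ + C\<^sub>-\<close> and \<open>N = C\<^sub>+ + B\<^sub>-\<close>; these multisets have equal size. The left-hand side is
  the cheapest matching of \<open>M\<close> with \<open>N\<close>. On the right-hand side the common points have
  disappeared: the Jordan parts of the measure are the counting measures of \<open>M - N\<close> and \<open>N - M\<close>
  (lemma \<open>jordan_decomposition_barcode_measure\<close>), and these may be coupled by measures that split
  mass, not only by matchings.

  Both differences are settled by duality. If \<open>f\<close> is 1-Lipschitz for the \<open>l1\<close> norm, then
  \<open>D f = (\<Sum>x\<in>#M. f x) - (\<Sum>x\<in>#N. f x)\<close> bounds from below the cost of each matching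
  (\<open>matching_cost_ge\<close>) and of each coupling (\<open>kantorovich_integral_ge\<close>). Moreover \<open>D f\<close> does not
  see common points: it is the same for the pair \<open>(M - N, N - M)\<close>. Conversely, any two multisets
  of equal size have a matching whose cost equals the value of some 1-Lipschitz \<open>f\<close>
  (\<open>matching_duality\<close>). Applied to \<open>(M, N)\<close> it gives an \<open>f\<close> with \<open>dW1 M N \<le> D f\<close>, which no coupling
  beats; applied to \<open>(M - N, N - M)\<close> it gives a matching, hence a coupling, whose cost is \<open>D f\<close> for
  another \<open>f\<close>, which no matching of \<open>M\<close> with \<open>N\<close> beats.

  The dual function comes from an optimal matching \<open>g\<close>. Exchanging partners along a cycle cannot
  lower its cost, so the graph with edge weights \<open>c i (g k) - c i (g i)\<close> has no negative cycle
  (\<open>closed_walk_nonneg\<close>). Shortest walks to a fixed vertex therefore have finite infima, and these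
  form a potential (\<open>potential_exists\<close>).
\<close>

section \<open>Potentials on graphs without negative cycles\<close>

fun walk_weight :: "('a \<Rightarrow> 'a \<Rightarrow> real) \<Rightarrow> 'a list \<Rightarrow> real" where
  "walk_weight w (x # y # zs) = w x y + walk_weight w (y # zs)"
| "walk_weight w _ = 0"

lemma walk_weight_split:
  "walk_weight w (xs @ y # ys) = walk_weight w (xs @ [y]) + walk_weight w (y # ys)"
  by (induction w xs rule: walk_weight.induct) simp_all

text \<open>The form in which a closed walk through distinct vertices is compared with a cyclic
  permutation: \<open>s\<close> sends each vertex of \<open>l\<close> to the next one, and the last vertex to \<open>b\<close>.\<close>

lemma walk_weight_eq_sum_successor:
  assumes "distinct l" "map s l = tl (l @ [b])"
  shows "walk_weight w (l @ [b]) = (\<Sum>z\<in>set l. w z (s z))"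
  using assms
proof (induction l)
  case (Cons z l)
  then show ?case by (cases l) auto
qed simp

text \<open>A closed walk without repeated vertices traces a cyclic permutation of \<open>I\<close>, whose fixed points
  cost nothing because \<open>w\<close> vanishes on the diagonal. A closed walk that meets a vertex twice splits
  there into two shorter closed walks.\<close>

lemma closed_walk_nonneg:
  fixes w :: "'a \<Rightarrow> 'a \<Rightarrow> real"
  assumes "finite I"
    and perm: "\<And>s. s permutes I \<Longrightarrow> 0 \<le> (\<Sum>i\<in>I. w i (s i))"
    and diag: "\<And>i. w i i = 0"
  shows "set (a # xs) \<subseteq> I \<Longrightarrow> 0 \<le> walk_weight w (a # xs @ [a])"
proof (induction "length xs" arbitrary: a xs rule: less_induct)
  case less
  show ?case
  proof (cases "distinct (a # xs)")
    case True
    define s where "s = cycle_of_list (a # xs)"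
    have s: "s permutes set (a # xs)"
      unfolding s_def by (rule cycle_permutes)
    have "map s (a # xs) = xs @ [a]"
      using cyclic_rotation[OF True, of 1] by (simp add: s_def)
    then have "walk_weight w ((a # xs) @ [a]) = (\<Sum>z\<in>set (a # xs). w z (s z))"
      by (intro walk_weight_eq_sum_successor True) simp
    also have "\<dots> = (\<Sum>z\<in>I. w z (s z))"
      using less.prems s diag \<open>finite I\<close>
      by (intro sum.mono_neutral_left) (auto simp: permutes_not_in)
    also have "\<dots> \<ge> 0"
      using permutes_subset[OF s less.prems] by (rule perm)
    finally show ?thesis by simp
  next
    case False
    then obtain ps y qs rs where split: "a # xs = ps @ [y] @ qs @ [y] @ rs"
      using not_distinct_decomp by blast
    have loop: "0 \<le> walk_weight w (y # qs @ [y])"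
    proof (rule less.hyps)
      show "length qs < length xs"
        using arg_cong[OF split, of length] by simp
      show "set (y # qs) \<subseteq> I"
        using less.prems split by auto
    qed
    have rest: "0 \<le> walk_weight w (ps @ y # rs @ [a])"
    proof -
      obtain zs where zs: "ps @ y # rs = a # zs"
        using split by (cases ps) auto
      have "0 \<le> walk_weight w (a # zs @ [a])"
      proof (rule less.hyps)
        show "length zs < length xs"
          using arg_cong[OF split, of length] arg_cong[OF zs, of length] by simp
        have "set (ps @ y # rs) \<subseteq> I"
          using less.prems unfolding split by auto
        then show "set (a # zs) \<subseteq> I" unfolding zs .
      qed
      moreover have "ps @ y # rs @ [a] = a # zs @ [a]"
        using arg_cong[OF zs, of "\<lambda>l. l @ [a]"] by simp
      ultimately show ?thesis by (simp only:)
    qed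
    have whole: "a # xs @ [a] = ps @ y # (qs @ y # (rs @ [a]))"
      using arg_cong[OF split, of "\<lambda>l. l @ [a]"] by simp
    have "walk_weight w (a # xs @ [a]) =
        walk_weight w (y # qs @ [y]) + walk_weight w (ps @ y # rs @ [a])"
      unfolding whole using walk_weight_split[of w ps y "qs @ y # rs @ [a]"]
        walk_weight_split[of w "y # qs" y "rs @ [a]"] walk_weight_split[of w ps y "rs @ [a]"]
      by simp
    then show ?thesis using loop rest by simp
  qed
qed

text \<open>The potential of \<open>i\<close> is the infimum of the weights of all walks in \<open>I\<close> from \<open>i\<close> to a fixed
  root \<open>r\<close>. The infimum is finite, since closing such a walk by the edge from \<open>r\<close> to \<open>i\<close> costs at
  least \<open>0\<close>; the inequality holds because a walk from \<open>i\<close> may start with the edge to \<open>k\<close>.\<close>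

lemma potential_exists:
  fixes w :: "'a \<Rightarrow> 'a \<Rightarrow> real"
  assumes "\<And>a xs. set (a # xs) \<subseteq> I \<Longrightarrow> 0 \<le> walk_weight w (a # xs @ [a])"
  obtains u where "\<And>i k. i \<in> I \<Longrightarrow> k \<in> I \<Longrightarrow> u i \<le> u k + w i k"
proof (cases "I = {}")
  case True
  then show ?thesis using that by blast
next
  case False
  then obtain r where r: "r \<in> I" by blast
  define u where "u i = (INF zs\<in>lists I. walk_weight w (i # zs @ [r]))" for i
  have bdd: "bdd_below ((\<lambda>zs. walk_weight w (i # zs @ [r])) ` lists I)" if "i \<in> I" for i
  proof (rule bdd_belowI2)
    fix zs assume "zs \<in> lists I"
    then have "0 \<le> walk_weight w (i # (zs @ [r]) @ [i])"
      using that r by (intro assms) auto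
    also have "\<dots> = walk_weight w (i # zs @ [r]) + w r i"
      using walk_weight_split[of w "i # zs" r "[i]"] by simp
    finally show "- w r i \<le> walk_weight w (i # zs @ [r])" by simp
  qed
  show ?thesis
  proof (rule that)
    fix i k assume ik: "i \<in> I" "k \<in> I"
    have "u i - w i k \<le> walk_weight w (k # zs @ [r])" if "zs \<in> lists I" for zs
    proof -
      have "u i \<le> walk_weight w (i # (k # zs) @ [r])"
        unfolding u_def using ik that by (intro cINF_lower bdd) auto
      then show ?thesis by simp
    qed
    then have "u i - w i k \<le> u k"
      unfolding u_def[of k] by (intro cINF_greatest) auto
    then show "u i \<le> u k + w i k" by simp
  qed
qed

text \<open>Linear programming duality for the assignment problem: \<open>g\<close> is a bijection of minimal cost, and
  \<open>u i\<close> is the price of the target \<open>g i\<close>, at which every source \<open>i\<close> finds its own partner to be the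
  cheapest target.\<close>

lemma optimal_assignment_potential:
  fixes c :: "'a \<Rightarrow> 'b \<Rightarrow> real"
  assumes fin: "finite A" "finite B" and card: "card A = card B"
  obtains g u where "bij_betw g A B"
    and "\<And>i k. i \<in> A \<Longrightarrow> k \<in> A \<Longrightarrow> u i + c i (g i) \<le> u k + c i (g k)"
proof -
  \<comment> \<open>There may be infinitely many functions that are bijections from \<open>A\<close> to \<open>B\<close>, as their values
     outside \<open>A\<close> are arbitrary; so the minimum is taken over the finitely many \<open>h \<circ> s\<close>, where \<open>s\<close>
     permutes \<open>A\<close>.\<close>
  obtain h where h: "bij_betw h A B"
    using finite_same_card_bij[OF fin card] by blast
  define cost where "cost s = (\<Sum>i\<in>A. c i (h (s i)))" for s
  have "finite {s. s permutes A}" "{s. s permutes A} \<noteq> {}"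
    using finite_permutations[OF fin(1)] permutes_id[of A] by blast+
  then obtain m where m: "m permutes A" "\<And>s. s permutes A \<Longrightarrow> cost m \<le> cost s"
    using arg_min_if_finite[of "{s. s permutes A}" cost]
    by (metis arg_min_least mem_Collect_eq)
  define g where "g = h \<circ> m"
  define w where "w i k = c i (g k) - c i (g i)" for i k
  have "0 \<le> walk_weight w (a # xs @ [a])" if "set (a # xs) \<subseteq> A" for a xs
  proof (rule closed_walk_nonneg[OF fin(1) _ _ that])
    fix s assume "s permutes A"
    then have "cost m \<le> cost (m \<circ> s)"
      by (intro m(2) permutes_compose m(1))
    then show "0 \<le> (\<Sum>i\<in>A. w i (s i))"
      by (simp add: w_def cost_def g_def sum_subtractf)
  qed (simp add: w_def)
  then obtain u where u: "\<And>i k. i \<in> A \<Longrightarrow> k \<in> A \<Longrightarrow> u i \<le> u k + w i k"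
    using potential_exists by blast
  show ?thesis
  proof (rule that)
    show "bij_betw g A B"
      unfolding g_def using permutes_imp_bij[OF m(1)] h by (rule bij_betw_trans)
    show "u i + c i (g i) \<le> u k + c i (g k)" if "i \<in> A" "k \<in> A" for i k
      using u[OF that] by (simp add: w_def)
  qed
qed

section \<open>Sums over multisets\<close>

lemma elems_eq_Sigma: "elems M = Sigma (set_mset M) (\<lambda>x. {..<count M x})"
  by (auto simp: elems_def) (metis count_eq_zero_iff not_less_zero)

lemma finite_elems: "finite (elems M)"
  by (simp add: elems_eq_Sigma)

lemma card_elems: "card (elems M) = size M"
  by (simp add: elems_eq_Sigma size_multiset_overloaded_eq)

lemma image_mset_fst_elems: "image_mset fst (mset_set (elems M)) = M"
proof (rule multiset_eqI)
  fix x
  have "fst -` {x} \<inter> elems M = Pair x ` {..<count M x}"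
    by (auto simp: elems_def)
  moreover have "card (Pair x ` {..<count M x}) = count M x"
    by (simp add: card_image inj_on_def)
  moreover have "(\<Sum>p\<in>fst -` {x} \<inter> elems M. count (mset_set (elems M)) p) =
      (\<Sum>p\<in>fst -` {x} \<inter> elems M. 1)"
    by (intro sum.cong) (auto simp: finite_elems)
  ultimately show "count (image_mset fst (mset_set (elems M))) x = count M x"
    by (simp add: count_image_mset finite_elems)
qed

lemma sum_elems: "(\<Sum>i\<in>elems M. f (fst i)) = (\<Sum>x\<in>#M. f x)"
proof -
  have "(\<Sum>x\<in>#M. f x) = (\<Sum>x\<in>#image_mset fst (mset_set (elems M)). f x)"
    by (simp only: image_mset_fst_elems)
  then show ?thesis
    by (simp add: sum_unfold_sum_mset multiset.map_comp o_def)
qed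

lemma sum_mset_diff_cancel:
  fixes f :: "'a \<Rightarrow> 'b::ab_group_add"
  shows "(\<Sum>x\<in>#M - N. f x) - (\<Sum>x\<in>#N - M. f x) = (\<Sum>x\<in>#M. f x) - (\<Sum>x\<in>#N. f x)"
proof -
  have "(M - N) + (M \<inter># N) = M" "(N - M) + (M \<inter># N) = N"
    by (auto intro!: multiset_eqI)
  then have "(\<Sum>x\<in>#M. f x) = (\<Sum>x\<in>#M - N. f x) + (\<Sum>x\<in>#M \<inter># N. f x)"
    "(\<Sum>x\<in>#N. f x) = (\<Sum>x\<in>#N - M. f x) + (\<Sum>x\<in>#M \<inter># N. f x)"
    by (metis image_mset_union sum_mset.union)+
  then show ?thesis by simp
qed

lemma size_diff_eq:
  fixes M N :: "'a multiset"
  assumes "size M = size N"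
  shows "size (M - N) = size (N - M)"
proof -
  have "int (size (M - N)) - int (size (N - M)) = int (size M) - int (size N)"
    using sum_mset_diff_cancel[of "\<lambda>_::'a. 1::int" M N] by simp
  then show ?thesis using assms by simp
qed

section \<open>Lipschitz functions and optimal matchings\<close>

lemma l1_norm_nonneg: "0 \<le> l1_norm x"
  by (simp add: l1_norm_def sum_nonneg)

lemma l1_norm_triangle: "l1_norm (x - z) \<le> l1_norm (x - y) + l1_norm (y - z)"
  unfolding l1_norm_def sum.distrib[symmetric] by (intro sum_mono) simp

lemma l1_norm_minus_commute: "l1_norm (x - y) = l1_norm (y - x)"
  by (simp add: l1_norm_def abs_minus_commute)

definition l1_Lipschitz :: "(real ^ 'n::finite \<Rightarrow> real) \<Rightarrow> bool" where
  "l1_Lipschitz f \<longleftrightarrow> (\<forall>x y. f x - f y \<le> l1_norm (x - y))"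

lemma l1_LipschitzD: "l1_Lipschitz f \<Longrightarrow> f x - f y \<le> l1_norm (x - y)"
  by (simp add: l1_Lipschitz_def)

text \<open>The \<open>l1\<close> norm is at most \<open>n\<close> times the Euclidean norm, so \<open>f\<close> is continuous.\<close>

lemma l1_Lipschitz_measurable:
  fixes f :: "real ^ 'n::finite \<Rightarrow> real"
  assumes "l1_Lipschitz f"
  shows "f \<in> borel_measurable borel"
proof -
  have "dist (f x) (f y) \<le> CARD('n) * dist x y" for x y
  proof -
    have "dist (f x) (f y) \<le> l1_norm (x - y)"
      using l1_LipschitzD[OF assms, of x y] l1_LipschitzD[OF assms, of y x]
      by (simp add: dist_real_def l1_norm_minus_commute[of y x] abs_le_iff)
    also have "\<dots> \<le> (\<Sum>i\<in>(UNIV::'n set). dist x y)"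
      unfolding l1_norm_def dist_norm by (intro sum_mono component_le_norm_cart)
    finally show ?thesis by simp
  qed
  then have "CARD('n)-lipschitz_on UNIV f"
    by (intro lipschitz_onI) auto
  then show ?thesis
    by (intro borel_measurable_continuous_onI lipschitz_on_continuous_on)
qed

lemma matching_cost_ge:
  assumes "l1_Lipschitz f" "bij_betw h (elems M) (elems N)"
  shows "(\<Sum>x\<in>#M. f x) - (\<Sum>x\<in>#N. f x) \<le> (\<Sum>i\<in>elems M. l1_norm (fst i - fst (h i)))"
proof -
  have "(\<Sum>x\<in>#M. f x) - (\<Sum>x\<in>#N. f x) = (\<Sum>i\<in>elems M. f (fst i) - f (fst (h i)))"
    using sum.reindex_bij_betw[OF assms(2), of "\<lambda>j. f (fst j)"]
    by (simp add: sum_elems[symmetric] sum_subtractf)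
  also have "\<dots> \<le> (\<Sum>i\<in>elems M. l1_norm (fst i - fst (h i)))"
    by (intro sum_mono l1_LipschitzD assms(1))
  finally show ?thesis .
qed

text \<open>From the prices \<open>u\<close> of an optimal matching \<open>g\<close>, let \<open>f z\<close> be the least value over \<open>k\<close> of
  \<open>u k\<close> plus the distance from \<open>z\<close> to the point of \<open>g k\<close>. As a minimum of 1-Lipschitz functions it
  is 1-Lipschitz. At a source \<open>i\<close> the minimum is attained for \<open>k = i\<close>, while at the point of \<open>g i\<close>
  it is at most \<open>u i\<close>; hence \<open>f\<close> drops by at least the full distance along each matched pair.\<close>

lemma matching_duality:
  fixes M N :: "('n::finite) barcode"
  assumes "size M = size N"
  obtains g f where "bij_betw g (elems M) (elems N)" "l1_Lipschitz f"
    "(\<Sum>i\<in>elems M. l1_norm (fst i - fst (g i))) = (\<Sum>x\<in>#M. f x) - (\<Sum>x\<in>#N. f x)"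
proof -
  obtain g u where g: "bij_betw g (elems M) (elems N)"
    and u: "\<And>i k. i \<in> elems M \<Longrightarrow> k \<in> elems M \<Longrightarrow>
      u i + l1_norm (fst i - fst (g i)) \<le> u k + l1_norm (fst i - fst (g k))"
    using optimal_assignment_potential[of "elems M" "elems N" "\<lambda>i j. l1_norm (fst i - fst j)"]
      finite_elems card_elems assms by metis
  show ?thesis
  proof (cases "elems M = {}")
    case True
    have "l1_Lipschitz (\<lambda>_::real^'n. 0)"
      by (simp add: l1_Lipschitz_def l1_norm_nonneg)
    then show ?thesis
      using True g by (intro that[of g "\<lambda>_. 0"]) auto
  next
    case False
    define f where "f z = Min ((\<lambda>k. u k + l1_norm (z - fst (g k))) ` elems M)" for z
    have le: "f z \<le> u k + l1_norm (z - fst (g k))" if "k \<in> elems M" for z k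
      unfolding f_def using that by (intro Min_le) (auto simp: finite_elems)
    have attained: "\<exists>k\<in>elems M. f z = u k + l1_norm (z - fst (g k))" for z
    proof -
      have "f z \<in> (\<lambda>k. u k + l1_norm (z - fst (g k))) ` elems M"
        unfolding f_def using False by (intro Min_in) (auto simp: finite_elems)
      then show ?thesis by blast
    qed
    have lip: "l1_Lipschitz f"
      unfolding l1_Lipschitz_def
    proof (intro allI)
      fix x y
      obtain k where k: "k \<in> elems M" "f y = u k + l1_norm (y - fst (g k))"
        using attained by blast
      show "f x - f y \<le> l1_norm (x - y)"
        using le[OF k(1), of x] k(2) l1_norm_triangle[of x "fst (g k)" y] by simp
    qed
    have tight: "l1_norm (fst i - fst (g i)) \<le> f (fst i) - f (fst (g i))" if "i \<in> elems M" for i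
    proof -
      obtain k where k: "k \<in> elems M" "f (fst i) = u k + l1_norm (fst i - fst (g k))"
        using attained by blast
      have "f (fst (g i)) \<le> u i"
        using le[OF that, of "fst (g i)"] by (simp add: l1_norm_def)
      then show ?thesis using u[OF that k(1)] k(2) by simp
    qed
    have "(\<Sum>i\<in>elems M. l1_norm (fst i - fst (g i))) \<le>
        (\<Sum>i\<in>elems M. f (fst i) - f (fst (g i)))"
      by (intro sum_mono tight)
    also have "\<dots> = (\<Sum>x\<in>#M. f x) - (\<Sum>x\<in>#N. f x)"
      using sum.reindex_bij_betw[OF g, of "\<lambda>j. f (fst j)"]
      by (simp add: sum_elems[symmetric] sum_subtractf)
    finally show ?thesis
      using that[OF g lip] matching_cost_ge[OF lip g] by simp
  qed
qed

section \<open>The measure of a multiset and its couplings\<close>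

text \<open>The sum of the Dirac measures at the points of \<open>M\<close>, with multiplicity. As a push-forward of the
  counting measure on the labelled copies it turns matchings, which are maps between copies,
  directly into couplings.\<close>

definition multiset_measure :: "'a::topological_space multiset \<Rightarrow> 'a measure" where
  "multiset_measure M = distr (count_space (elems M)) borel fst"

lemma sets_multiset_measure: "sets (multiset_measure M) = sets borel"
  by (simp add: multiset_measure_def)

lemma finite_measure_multiset_measure: "finite_measure (multiset_measure M)"
  unfolding multiset_measure_def
  by (intro finite_measure.finite_measure_distr finite_measure_count_space finite_elems) simp

lemma integrable_multiset_measure:
  fixes f :: "'a::topological_space \<Rightarrow> real"
  assumes "f \<in> borel_measurable borel"
  shows "integrable (multiset_measure M) f"
  unfolding multiset_measure_def
  by (subst integrable_distr_eq) (auto simp: assms finite_elems intro: integrable_count_space)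

lemma integral_multiset_measure:
  fixes f :: "'a::topological_space \<Rightarrow> real"
  assumes "f \<in> borel_measurable borel"
  shows "integral\<^sup>L (multiset_measure M) f = (\<Sum>x\<in>#M. f x)"
proof -
  have "integral\<^sup>L (multiset_measure M) f = (\<Sum>i\<in>elems M. f (fst i))"
    unfolding multiset_measure_def using assms
    by (subst integral_distr) (auto simp: finite_elems lebesgue_integral_count_space_finite)
  then show ?thesis by (simp add: sum_elems)
qed

lemma measure_multiset_measure:
  assumes "A \<in> sets borel"
  shows "measure (multiset_measure M) A = (\<Sum>x\<in>#M. indicator A x)"
proof -
  have "space (multiset_measure M) = UNIV"
    by (simp add: multiset_measure_def)
  then show ?thesis
    using integral_multiset_measure[of "indicator A :: _ \<Rightarrow> real" M] assms by simp
qed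

lemma coupling_of_matching:
  assumes h: "bij_betw h (elems M) (elems N)"
  shows "distr (count_space (elems M)) (borel \<Otimes>\<^sub>M borel) (\<lambda>i. (fst i, fst (h i)))
    \<in> couplings (multiset_measure M) (multiset_measure N)"
proof -
  have "distr (count_space (elems M)) borel (fst \<circ> h) =
      distr (distr (count_space (elems M)) (count_space (elems N)) h) borel fst"
    using bij_betwE[OF h] by (subst distr_distr) auto
  also have "\<dots> = multiset_measure N"
    by (simp add: distr_bij_count_space[OF h] multiset_measure_def)
  finally have "distr (count_space (elems M)) borel (fst \<circ> h) = multiset_measure N" .
  then show ?thesis
    unfolding couplings_def
    by (simp add: distr_distr multiset_measure_def o_def space_pair_measure)
qed

text \<open>For a coupling \<open>\<psi>\<close> the left-hand side is the integral of \<open>f x - f y\<close> over \<open>\<psi>\<close>: integrals of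
  functions of one coordinate depend only on the marginals.\<close>

lemma kantorovich_integral_ge:
  fixes f :: "real ^ 'n::finite \<Rightarrow> real"
  assumes f: "l1_Lipschitz f" and \<psi>: "\<psi> \<in> couplings (multiset_measure M) (multiset_measure N)"
  shows "ennreal ((\<Sum>x\<in>#M. f x) - (\<Sum>x\<in>#N. f x)) \<le> (\<integral>\<^sup>+ (x, y). ennreal (l1_norm (x - y)) \<partial>\<psi>)"
proof -
  note meas [measurable] = l1_Lipschitz_measurable[OF f]
  have sets [measurable_cong]: "sets \<psi> = sets (borel \<Otimes>\<^sub>M borel)"
    and fst: "distr \<psi> borel fst = multiset_measure M"
    and snd: "distr \<psi> borel snd = multiset_measure N"
    using \<psi> by (auto simp: couplings_def)
  have int: "integrable \<psi> (\<lambda>p. f (fst p))" "integrable \<psi> (\<lambda>p. f (snd p))"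
    using integrable_multiset_measure[OF meas, of M] integrable_multiset_measure[OF meas, of N]
    unfolding fst[symmetric] snd[symmetric] by (simp_all add: integrable_distr_eq)
  have val: "(\<integral>p. f (fst p) \<partial>\<psi>) = (\<Sum>x\<in>#M. f x)" "(\<integral>p. f (snd p) \<partial>\<psi>) = (\<Sum>x\<in>#N. f x)"
    using integral_multiset_measure[OF meas, of M] integral_multiset_measure[OF meas, of N]
    unfolding fst[symmetric] snd[symmetric] by (simp_all add: integral_distr)
  define e where "e p = f (fst p) - f (snd p)" for p
  have e: "integrable \<psi> e"
    unfolding e_def using int by simp
  have "ennreal ((\<Sum>x\<in>#M. f x) - (\<Sum>x\<in>#N. f x)) = ennreal (\<integral>p. e p \<partial>\<psi>)"
    unfolding e_def using int val by simp
  also have "\<dots> \<le> ennreal (\<integral>p. max 0 (e p) \<partial>\<psi>)"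
    using e by (intro ennreal_leI integral_mono) auto
  also have "\<dots> = (\<integral>\<^sup>+ p. ennreal (max 0 (e p)) \<partial>\<psi>)"
    using e by (intro nn_integral_eq_integral[symmetric]) auto
  also have "\<dots> \<le> (\<integral>\<^sup>+ (x, y). ennreal (l1_norm (x - y)) \<partial>\<psi>)"
    using l1_LipschitzD[OF f]
    by (intro nn_integral_mono) (auto simp: e_def l1_norm_nonneg split: prod.split intro!: ennreal_leI)
  finally show ?thesis .
qed

section \<open>The Kantorovich norm of a difference of barcode measures\<close>

text \<open>The multisets \<open>M - N\<close> and \<open>N - M\<close> have no common element, so the finite set of points of
  \<open>M - N\<close> separates the two measures.\<close>

lemma jordan_decomposition_barcode_measure:
  fixes B C :: "('n::finite) signed_barcode"
  defines "M \<equiv> pos_bars B + neg_bars C" and "N \<equiv> pos_bars C + neg_bars B"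
  shows "jordan_decomposition (barcode_measure B - barcode_measure C) =
    (multiset_measure (M - N), multiset_measure (N - M))"
proof -
  have diff: "(barcode_measure B - barcode_measure C) A =
      measure (multiset_measure (M - N)) A - measure (multiset_measure (N - M)) A"
    if "A \<in> sets borel" for A
    using that sum_mset_diff_cancel[of "indicator A :: _ \<Rightarrow> real" M N]
    by (simp add: measure_multiset_measure barcode_measure_def measure_return M_def N_def)
  have H: "set_mset (M - N) \<in> sets borel"
    by (intro borel_closed finite_imp_closed) simp
  have "measure (multiset_measure (M - N)) (- set_mset (M - N)) = 0"
  proof -
    have "(\<Sum>x\<in>#M - N. indicator (- set_mset (M - N)) x) = (\<Sum>x\<in>#M - N. 0::real)"
      by (intro arg_cong[of _ _ sum_mset] image_mset_cong) simp
    then show ?thesis using H by (simp add: measure_multiset_measure)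
  qed
  moreover have "measure (multiset_measure (N - M)) (set_mset (M - N)) = 0"
  proof -
    have "(\<Sum>x\<in>#N - M. indicator (set_mset (M - N)) x) = (\<Sum>x\<in>#N - M. 0::real)"
      by (intro arg_cong[of _ _ sum_mset] image_mset_cong)
        (auto simp: indicator_def in_diff_count)
    then show ?thesis using H by (simp add: measure_multiset_measure)
  qed
  ultimately have "is_jordan_decomposition (barcode_measure B - barcode_measure C)
      (multiset_measure (M - N), multiset_measure (N - M))"
    unfolding is_jordan_decomposition_def using H diff
    by (auto simp: finite_measure_multiset_measure sets_multiset_measure)
  then show ?thesis
    unfolding jordan_decomposition_def
    by (intro the_equality is_jordan_decomposition_unique[of "barcode_measure B - barcode_measure C"])
qed

theorem proposition6p11:
  fixes B C :: "('n::finite) signed_barcode"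
  assumes "total_mass B = total_mass C"
  shows "signed_dW1 B C = kantorovich_norm (barcode_measure B - barcode_measure C)"
proof -
  define M where "M = pos_bars B + neg_bars C"
  define N where "N = pos_bars C + neg_bars B"
  have size: "size M = size N"
    using assms by (simp add: M_def N_def total_mass_def)
  have norm: "kantorovich_norm (barcode_measure B - barcode_measure C) =
      (INF \<psi> \<in> couplings (multiset_measure (M - N)) (multiset_measure (N - M)).
        \<integral>\<^sup>+ (x, y). ennreal (l1_norm (x - y)) \<partial>\<psi>)"
    unfolding kantorovich_norm_def jordan_decomposition_barcode_measure M_def N_def by simp
  \<comment> \<open>The potential of an optimal matching of \<open>M\<close> with \<open>N\<close> bounds every coupling from below.\<close>
  have "dW1 M N \<le> kantorovich_norm (barcode_measure B - barcode_measure C)"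
  proof -
    obtain g f where g: "bij_betw g (elems M) (elems N)" and f: "l1_Lipschitz f"
      and eq: "(\<Sum>i\<in>elems M. l1_norm (fst i - fst (g i))) = (\<Sum>x\<in>#M. f x) - (\<Sum>x\<in>#N. f x)"
      using matching_duality[OF size] .
    have "dW1 M N \<le> ennreal ((\<Sum>x\<in>#M. f x) - (\<Sum>x\<in>#N. f x))"
      unfolding dW1_def eq[symmetric] using g by (intro INF_lower) simp
    also have "\<dots> \<le> kantorovich_norm (barcode_measure B - barcode_measure C)"
      unfolding norm sum_mset_diff_cancel[of f M N, symmetric]
      by (intro INF_greatest kantorovich_integral_ge f)
    finally show ?thesis .
  qed
  \<comment> \<open>An optimal matching of the reduced multisets is a coupling, and its potential bounds every
     matching of \<open>M\<close> with \<open>N\<close> from below.\<close>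
  moreover have "kantorovich_norm (barcode_measure B - barcode_measure C) \<le> dW1 M N"
  proof -
    obtain g f where g: "bij_betw g (elems (M - N)) (elems (N - M))" and f: "l1_Lipschitz f"
      and eq: "(\<Sum>i\<in>elems (M - N). l1_norm (fst i - fst (g i))) =
        (\<Sum>x\<in>#M - N. f x) - (\<Sum>x\<in>#N - M. f x)"
      using matching_duality[OF size_diff_eq[OF size]] .
    define \<psi> where "\<psi> = distr (count_space (elems (M - N))) (borel \<Otimes>\<^sub>M borel) (\<lambda>i. (fst i, fst (g i)))"
    have [measurable]: "(l1_norm :: real ^ 'n \<Rightarrow> real) \<in> borel_measurable borel"
      unfolding l1_norm_def by measurable
    have "kantorovich_norm (barcode_measure B - barcode_measure C) \<le>
        (\<integral>\<^sup>+ (x, y). ennreal (l1_norm (x - y)) \<partial>\<psi>)"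
      unfolding norm \<psi>_def by (intro INF_lower coupling_of_matching g)
    also have "\<dots> = ennreal (\<Sum>i\<in>elems (M - N). l1_norm (fst i - fst (g i)))"
      unfolding \<psi>_def
      by (subst nn_integral_distr)
        (auto simp: space_pair_measure
         nn_integral_count_space_finite finite_elems sum_ennreal l1_norm_nonneg)
    also have "\<dots> = ennreal ((\<Sum>x\<in>#M. f x) - (\<Sum>x\<in>#N. f x))"
      unfolding eq sum_mset_diff_cancel ..
    also have "\<dots> \<le> dW1 M N"
      unfolding dW1_def by (intro INF_greatest ennreal_leI matching_cost_ge f) simp
    finally show ?thesis .
  qed
  ultimately show ?thesis
    unfolding signed_dW1_def M_def N_def by (rule antisym)
qed

end
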